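(* Let $q$ be an odd prime power, $\beta\in\mathbb{F}_q^*$, and let $\theta_1,\theta_2\in\mathbb{F}_{q^2}$ form an $\mathbb{F}_q$-basis of $\mathbb{F}_{q^2}$ with $\mathrm{Tr}(\theta_1)=\beta$, $\mathrm{Tr}(\theta_2)=0$. Let $q_2'$ be the product of the distinct odd primes dividing $q^2-1$ and write $q_2'=k\,p_1\cdots p_s$ with $p_1,\dots,p_s$ distinct primes (not dividing $k$), ordered so that $p_i\mid q+1$ for $1\le i\le r$ and $p_i\nmid q+1$ for $r<i\le s$. Let $\varepsilon=1-\sum_{i=1}^s1/p_i$ ($\varepsilon=1$ if $s=0$), $\varepsilon'=1-\sum_{i=1}^r1/p_i$, and let $k_1$ be the largest divisor of $k$ dividing $q+1$. Assume $\varepsilon>0$. (1) If $q\equiv1\pmod4$ and $q+1>4\Big[W(k)\big(\frac{s-1}{\varepsilon}+2\big)\sqrt q-W(k_1)\big(\frac{r-1+\varepsilon'}{\varepsilon}+1\big)\frac{\sqrt q-1}{2}\Big]$, then $\mathcal{Q}_{q_2'}\ne0$. (2) If $q\equiv3\pmod4$ and $q+1>4\Big[W(k)\big(\frac{s-1}{\varepsilon}+2\big)\sqrt q-W(k_1)\big(\frac{r-1+\varepsilon'}{\varepsilon}+1\big)(\sqrt q-1)\Big]$, then $\mathcal{Q}_{q_2'}\ne0$.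
   Context: $\mathrm{Tr}(x)=x+x^q$ for $x\in\mathbb{F}_{q^2}$. For $t\mid q^2-1$, $\xi\in\mathbb{F}_{q^2}^*$ is $t$-free if $\xi=\zeta^d$ with $d\mid t$, $\zeta\in\mathbb{F}_{q^2}^*$ implies $d=1$. For $t\mid q_2'$, $\mathcal{Q}_t$ is the number of $\alpha\in\mathbb{F}_q$ such that $\theta_1+\alpha\theta_2$ is $t$-free and is a square but not a fourth power in $\mathbb{F}_{q^2}^*$. $W(t)$ is the number of square-free divisors of $t$. *)

theory Defs
  imports Complex_Main "HOL-Library.Cardinality" "HOL-Computational_Algebra.Squarefree" "HOL-Number_Theory.Number_Theory"
begin

definition is_subfield :: "'a::field set \<Rightarrow> bool" where
  "is_subfield K \<longleftrightarrow> 0 \<in> K \<and> 1 \<in> K \<and>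
     (\<forall>x\<in>K. \<forall>y\<in>K. x + y \<in> K \<and> x * y \<in> K) \<and>
     (\<forall>x\<in>K. - x \<in> K) \<and> (\<forall>x\<in>K. x \<noteq> 0 \<longrightarrow> inverse x \<in> K)"

definition is_basis2 :: "'a::field set \<Rightarrow> 'a \<Rightarrow> 'a \<Rightarrow> bool" where
  "is_basis2 K u v \<longleftrightarrow>
     (\<forall>a\<in>K. \<forall>b\<in>K. a * u + b * v = 0 \<longrightarrow> a = 0 \<and> b = 0) \<and>
     (\<forall>x. \<exists>a\<in>K. \<exists>b\<in>K. x = a * u + b * v)"

definition Tr :: "nat \<Rightarrow> 'a::field \<Rightarrow> 'a" where
  "Tr q x = x + x ^ q"

definition t_free :: "nat \<Rightarrow> 'a::field \<Rightarrow> bool" where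
  "t_free t \<xi> \<longleftrightarrow> \<xi> \<noteq> 0 \<and> (\<forall>d \<zeta>. d dvd t \<and> \<zeta> \<noteq> 0 \<and> \<xi> = \<zeta> ^ d \<longrightarrow> d = 1)"

definition is_nonzero_power :: "nat \<Rightarrow> 'a::field \<Rightarrow> bool" where
  "is_nonzero_power n x \<longleftrightarrow> (\<exists>y. y \<noteq> 0 \<and> x = y ^ n)"

definition Q_count :: "'a::field set \<Rightarrow> 'a \<Rightarrow> 'a \<Rightarrow> nat \<Rightarrow> nat" where
  "Q_count K \<theta>1 \<theta>2 t =
     card {\<alpha> \<in> K. t_free t (\<theta>1 + \<alpha> * \<theta>2) \<and>
                 is_nonzero_power 2 (\<theta>1 + \<alpha> * \<theta>2) \<and> \<not> is_nonzero_power 4 (\<theta>1 + \<alpha> * \<theta>2)}"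

definition W :: "nat \<Rightarrow> nat" where
  "W t = card {d. d dvd t \<and> squarefree d}"

definition odd_radical :: "nat \<Rightarrow> nat" where
  "odd_radical n = \<Prod>{p. prime p \<and> odd p \<and> p dvd n}"

end

theory Submission
  imports Defs "HOL-Library.FuncSet" "HOL-Library.Real_Mod"
begin

text \<open>
  For a multiplicative character \<open>\<chi>\<close> of the big field \<open>F\<close> let \<open>S(\<chi>)\<close> be its sum over the line
  \<open>{\<theta>1 + \<alpha> \<theta>2 | \<alpha> \<in> K}\<close>. The quotients of distinct points of the line run exactly once
  through \<open>F - K\<close>, so \<open>|S(\<chi>)|\<^sup>2 = q - (\<Sum>x\<in>K. \<chi> x)\<close> for \<open>\<chi> \<noteq> 1\<close>. Hence \<open>|S(\<chi>)|\<close> is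
  \<open>1\<close> if \<open>\<chi>\<close> is trivial on the units of \<open>K\<close>, i.e. if its order divides \<open>q + 1\<close>, and \<open>sqrt q\<close> otherwise.

  For a prime \<open>p\<close> dividing \<open>q\<^sup>2 - 1\<close> the indicator of the elements that are not \<open>p\<close>-th powers is
  \<open>(1 - 1/p) (1 + f\<^sub>p)\<close>, where \<open>- f\<^sub>p\<close> is the mean of the \<open>p - 1\<close> characters of order \<open>p\<close>, and
  the indicator of the squares that are not fourth powers is a quarter of an alternating sum of the four
  characters of order dividing 4. Multiplying out over a set \<open>P\<close> of odd primes, a nonempty subset \<open>D\<close>
  of \<open>P\<close> contributes at most \<open>4 sqrt q\<close>, and only \<open>2 + 2 sqrt q\<close> (if \<open>q \<equiv> 1\<close> modulo 4) or 4
  (if \<open>q \<equiv> 3\<close> modulo 4) when all primes of \<open>D\<close> divide \<open>q + 1\<close>; the trivial character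
  contributes \<open>q\<close>. The primes \<open>p\<^sub>1, \<dots>, p\<^sub>s\<close> are treated by the union bound
  \<open>Q(P \<union> R) \<ge> Q(P) - (\<Sum>p\<in>R. Q(P) - Q(P \<union> {p}))\<close>.
\<close>

section \<open>Roots of unity\<close>

lemma power_cong_of_power_eq_1:
  fixes z :: "'a::monoid_mult"
  assumes "z ^ d = 1" and "[m = n] (mod d)"
  shows "z ^ m = z ^ n"
proof -
  have power_mod: "z ^ k = z ^ (k mod d)" for k
  proof -
    have "z ^ k = z ^ (d * (k div d) + k mod d)"
      by simp
    also have "\<dots> = z ^ (k mod d)"
      unfolding power_add power_mult assms(1) by simp
    finally show ?thesis .
  qed
  have "z ^ m = z ^ (m mod d)"
    by (rule power_mod)
  also have "m mod d = n mod d"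
    using assms(2) by (simp add: cong_def)
  also have "z ^ (n mod d) = z ^ n"
    by (rule power_mod [symmetric])
  finally show ?thesis .
qed

lemma sum_powers_root_of_unity:
  fixes z :: "'a::field"
  assumes "z ^ n = 1"
  shows "(\<Sum>j<n. z ^ j) = (if z = 1 then of_nat n else 0)"
  using assms by (simp add: geometric_sum)

lemma cis_two_pi_div_power_eq_1_iff:
  assumes "d > 0"
  shows "cis (2 * pi / real d) ^ n = 1 \<longleftrightarrow> d dvd n"
proof -
  have "cis (2 * pi / real d) ^ n = 1 \<longleftrightarrow> (\<exists>k::int. real n = real_of_int (k * int d))"
    using assms by (auto simp: DeMoivre cis_eq_1_iff field_simps)
  also have "\<dots> \<longleftrightarrow> (\<exists>k::int. int n = k * int d)"
    by (metis of_int_eq_iff of_int_of_nat_eq)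
  also have "\<dots> \<longleftrightarrow> int d dvd int n"
    by (auto simp: dvd_def mult.commute)
  finally show ?thesis
    by simp
qed

section \<open>Powers in finite fields\<close>

lemma is_subfieldD:
  assumes "is_subfield K"
  shows "0 \<in> K" and "1 \<in> K"
    and "x \<in> K \<Longrightarrow> y \<in> K \<Longrightarrow> x + y \<in> K" and "x \<in> K \<Longrightarrow> y \<in> K \<Longrightarrow> x - y \<in> K"
    and "x \<in> K \<Longrightarrow> y \<in> K \<Longrightarrow> x * y \<in> K" and "x \<in> K \<Longrightarrow> y \<in> K \<Longrightarrow> x / y \<in> K"
proof -
  have inverse: "inverse y \<in> K" if "y \<in> K" for y
    using assms that by (cases "y = 0") (auto simp: is_subfield_def)
  show "x - y \<in> K" if "x \<in> K" "y \<in> K"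
    using assms that by (metis diff_conv_add_uminus is_subfield_def)
  show "x / y \<in> K" if "x \<in> K" "y \<in> K"
    using assms that inverse by (simp add: divide_inverse is_subfield_def)
qed (use assms in \<open>auto simp: is_subfield_def\<close>)

lemma subfield_power_card_eq_1:
  fixes x :: "'a::{field,finite}"
  assumes K: "is_subfield K" and x: "x \<in> K" "x \<noteq> 0"
  shows "x ^ (card K - 1) = 1"
proof -
  let ?U = "K - {0}"
  have inj: "inj_on ((*) x) ?U"
    using x by (auto simp: inj_on_def)
  have "(*) x ` ?U = ?U"
    using x is_subfieldD(5) [OF K] by (intro endo_inj_surj inj) auto
  then have "\<Prod>?U = \<Prod>((*) x ` ?U)"
    by simp
  also have "\<dots> = x ^ (card K - 1) * \<Prod>?U"
    using inj is_subfieldD(1) [OF K] by (simp add: prod.reindex prod.distrib card_Diff_singleton)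
  finally show ?thesis
    by simp
qed

lemma power_card_eq_1:
  fixes x :: "'a::{field,finite}"
  assumes "x \<noteq> 0"
  shows "x ^ (CARD('a) - 1) = 1"
  by (rule subfield_power_card_eq_1) (use assms in \<open>auto simp: is_subfield_def\<close>)

lemma card_units_pos: "CARD('a::{field,finite}) - 1 > 0"
proof -
  have "card {0, 1 :: 'a} \<le> CARD('a)"
    by (rule card_mono) auto
  then show ?thesis
    by simp
qed

definition primitive_element :: "'a::field \<Rightarrow> bool" where
  "primitive_element g \<longleftrightarrow> (\<forall>x. x \<noteq> 0 \<longleftrightarrow> (\<exists>n. x = g ^ n))"

lemma ex_primitive_element: "\<exists>g :: 'a::{field,finite}. primitive_element g"
proof -
  define R where "R = \<lparr>carrier = UNIV :: 'a set, monoid.mult = (*), one = (1 :: 'a),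
    zero = (0 :: 'a), add = (+)\<rparr>"
  have inverse: "\<exists>y. x * y = 1" if "x \<noteq> 0" for x :: 'a
    using that by (intro exI [of _ "inverse x"]) simp
  interpret field R
    by unfold_locales
      (auto simp: R_def Units_def mult_ac distrib_left inverse left_minus right_minus
        intro: exI [of _ "- x" for x])
  have pow: "x [^]\<^bsub>R\<^esub> n = x ^ n" for x :: 'a and n :: nat
    by (induction n) (simp_all add: R_def mult.commute)
  have "finite (carrier R)"
    by (simp add: R_def)
  then obtain g where "carrier (mult_of R) = {g [^]\<^bsub>R\<^esub> n | n :: nat. n \<in> UNIV}"
    using finite_field_mult_group_has_gen by blast
  then have "- {0} = range (\<lambda>n. g ^ n)"
    unfolding pow by (auto simp: R_def)
  then have "primitive_element g"
    by (auto simp: primitive_element_def)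
  then show ?thesis ..
qed

lemma primitive_element_power_eq_iff:
  fixes g :: "'a::{field,finite}"
  assumes g: "primitive_element g"
  shows "g ^ m = g ^ n \<longleftrightarrow> [m = n] (mod (CARD('a) - 1))"
proof
  let ?N = "CARD('a) - 1"
  have "g \<noteq> 0"
    using g by (metis power_one_right primitive_element_def)
  then have g_N: "g ^ ?N = 1"
    by (rule power_card_eq_1)
  have power_mod: "g ^ n = g ^ (n mod ?N)" for n
    by (rule power_cong_of_power_eq_1 [OF g_N]) (simp add: cong_def)
  show "g ^ m = g ^ n" if "[m = n] (mod ?N)"
    using g_N that by (rule power_cong_of_power_eq_1)
  have "- {0 :: 'a} \<subseteq> (\<lambda>n. g ^ n) ` {..<?N}"
  proof
    fix x :: 'a assume "x \<in> - {0}"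
    then obtain n where "x = g ^ n"
      using g by (auto simp: primitive_element_def)
    then show "x \<in> (\<lambda>n. g ^ n) ` {..<?N}"
      using power_mod [of n] card_units_pos [where ?'a = 'a] by auto
  qed
  moreover have "(\<lambda>n. g ^ n) ` {..<?N} \<subseteq> - {0}"
    using \<open>g \<noteq> 0\<close> by auto
  ultimately have "card ((\<lambda>n. g ^ n) ` {..<?N}) = ?N"
    by (metis Compl_eq_Diff_UNIV UNIV_I card_Diff_singleton subset_antisym)
  then have "inj_on (\<lambda>n. g ^ n) {..<?N}"
    by (intro eq_card_imp_inj_on) simp_all
  then show "[m = n] (mod ?N)" if "g ^ m = g ^ n"
    using that power_mod [of m] power_mod [of n] card_units_pos [where ?'a = 'a]
    by (auto simp: cong_def inj_on_def)
qed

lemma is_nonzero_power_primitive_element_iff: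
  fixes g :: "'a::{field,finite}"
  assumes g: "primitive_element g" and d: "d dvd CARD('a) - 1"
  shows "is_nonzero_power d (g ^ n) \<longleftrightarrow> d dvd n"
proof
  assume "is_nonzero_power d (g ^ n)"
  then obtain m where "g ^ n = (g ^ m) ^ d"
    using g by (auto simp: is_nonzero_power_def primitive_element_def)
  then have "g ^ n = g ^ (m * d)"
    by (simp add: power_mult)
  then have "[n = m * d] (mod d)"
    using primitive_element_power_eq_iff [OF g] d by (blast intro: cong_dvd_modulus_nat)
  then show "d dvd n"
    by (simp add: cong_def mod_eq_0_iff_dvd)
next
  assume "d dvd n"
  then obtain m where "n = m * d"
    by (metis dvd_div_mult_self)
  then show "is_nonzero_power d (g ^ n)"
    using g by (auto simp: is_nonzero_power_def primitive_element_def power_mult)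
qed

lemma is_nonzero_power_power_iff:
  fixes x :: "'a::{field,finite}"
  assumes "d * e dvd CARD('a) - 1" and "x \<noteq> 0"
  shows "is_nonzero_power (d * e) (x ^ e) \<longleftrightarrow> is_nonzero_power d x"
proof -
  obtain g :: 'a where g: "primitive_element g"
    using ex_primitive_element by blast
  then obtain n where n: "x = g ^ n"
    using assms(2) by (auto simp: primitive_element_def)
  have "e > 0"
    using assms(1) card_units_pos [where ?'a = 'a] by (intro gr0I) simp
  moreover have "d dvd CARD('a) - 1"
    using assms(1) by (rule dvd_mult_left)
  ultimately show ?thesis
    unfolding n power_mult [symmetric]
    by (simp only: is_nonzero_power_primitive_element_iff [OF g] assms(1)) simp
qed

lemma is_nonzero_power_of_power_eq_1:
  fixes x :: "'a::{field,finite}"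
  assumes "CARD('a) - 1 = e * m" and "x \<noteq> 0" and "x ^ e = 1"
  shows "is_nonzero_power m x"
proof -
  obtain g :: 'a where g: "primitive_element g"
    using ex_primitive_element by blast
  then obtain n where n: "x = g ^ n"
    using assms(2) by (auto simp: primitive_element_def)
  have "g ^ (e * n) = x ^ e"
    by (simp add: n mult.commute flip: power_mult)
  also have "\<dots> = g ^ 0"
    using assms(3) by simp
  finally have "e * m dvd e * n"
    unfolding primitive_element_power_eq_iff [OF g] assms(1) by (simp add: cong_0_iff)
  moreover have "e > 0"
    using assms(1) card_units_pos [where ?'a = 'a] by (intro gr0I) simp
  ultimately show ?thesis
    using assms(1) g n by (simp add: is_nonzero_power_primitive_element_iff)
qed

section \<open>Multiplicative characters\<close>

text \<open>The value at \<open>0\<close> is left free, so that characters are closed under pointwise powers even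
  when the exponent is \<open>0\<close>; it is \<open>0\<close> for nontrivial characters.\<close>

definition mult_character :: "('a::field \<Rightarrow> complex) \<Rightarrow> bool" where
  "mult_character \<chi> \<longleftrightarrow> \<chi> 1 = 1 \<and> (\<forall>x y. \<chi> (x * y) = \<chi> x * \<chi> y)"

lemma mult_character_one [simp]: "mult_character \<chi> \<Longrightarrow> \<chi> 1 = 1"
  by (simp add: mult_character_def)

lemma mult_character_mult: "mult_character \<chi> \<Longrightarrow> \<chi> (x * y) = \<chi> x * \<chi> y"
  by (simp add: mult_character_def)

lemma mult_character_power: "mult_character \<chi> \<Longrightarrow> \<chi> (x ^ n) = \<chi> x ^ n"
  by (induction n) (simp_all add: mult_character_mult)

lemma mult_character_times:
  "mult_character \<chi> \<Longrightarrow> mult_character \<psi> \<Longrightarrow> mult_character (\<lambda>x. \<chi> x * \<psi> x)"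
  by (simp add: mult_character_def)

lemma mult_character_pointwise_power: "mult_character \<chi> \<Longrightarrow> mult_character (\<lambda>x. \<chi> x ^ n)"
  by (simp add: mult_character_def power_mult_distrib)

lemma mult_character_prod:
  "(\<And>i. i \<in> I \<Longrightarrow> mult_character (\<chi> i)) \<Longrightarrow> mult_character (\<lambda>x. \<Prod>i\<in>I. \<chi> i x)"
  by (simp add: mult_character_def prod.distrib)

lemma norm_mult_character:
  fixes x :: "'a::{field,finite}"
  assumes "mult_character \<chi>" and "x \<noteq> 0"
  shows "norm (\<chi> x) = 1"
proof -
  have "\<chi> x ^ (CARD('a) - 1) = 1"
    using assms(1) by (simp only: power_card_eq_1 [OF assms(2)] mult_character_one
        flip: mult_character_power [OF assms(1)])
  then show ?thesis
    using power_eq_1_iff card_units_pos [where ?'a = 'a] by (metis less_irrefl)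
qed

lemma mult_character_divide:
  fixes x y :: "'a::{field,finite}"
  assumes "mult_character \<chi>" and "y \<noteq> 0"
  shows "\<chi> (x / y) = \<chi> x * cnj (\<chi> y)"
proof -
  have "\<chi> x = \<chi> (x / y) * \<chi> y"
    using assms by (simp flip: mult_character_mult)
  moreover have "\<chi> y * cnj (\<chi> y) = 1"
    using norm_mult_character [OF assms] by (simp flip: complex_norm_square)
  ultimately show ?thesis
    by (simp add: mult.assoc)
qed

lemma nontrivial_mult_character_0:
  assumes "mult_character \<chi>" and "\<chi> c \<noteq> 1"
  shows "\<chi> 0 = 0"
  using assms mult_character_mult [OF assms(1), of 0 c] by simp

lemma sum_mult_character_eq_0:
  assumes "mult_character \<chi>" and "c \<noteq> 0" "\<chi> c \<noteq> 1" and "(*) c ` H = H"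
  shows "(\<Sum>x\<in>H. \<chi> x) = 0"
proof -
  have "(\<Sum>x\<in>H. \<chi> x) = (\<Sum>x\<in>(*) c ` H. \<chi> x)"
    using assms(4) by simp
  also have "\<dots> = \<chi> c * (\<Sum>x\<in>H. \<chi> x)"
    using assms(1,2) by (simp add: sum.reindex inj_on_def mult_character_mult sum_distrib_left)
  finally show ?thesis
    using assms(3) by simp
qed

lemma sum_subfield_mult_character_eq_0:
  fixes \<chi> :: "'a::{field,finite} \<Rightarrow> complex"
  assumes "is_subfield K" and "mult_character \<chi>" and c: "c \<in> K" "c \<noteq> 0" "\<chi> c \<noteq> 1"
  shows "(\<Sum>x\<in>K. \<chi> x) = 0"
proof (rule sum_mult_character_eq_0)
  show "(*) c ` K = K"
    using c is_subfieldD(5) [OF assms(1)] by (intro endo_inj_surj) (auto simp: inj_on_def)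
qed (use assms in auto)

lemma sum_subfield_trivial_mult_character:
  fixes \<chi> :: "'a::{field,finite} \<Rightarrow> complex"
  assumes K: "is_subfield K" and "\<chi> 0 = 0" and "\<And>x. x \<in> K \<Longrightarrow> x \<noteq> 0 \<Longrightarrow> \<chi> x = 1"
  shows "(\<Sum>x\<in>K. \<chi> x) = of_nat (card K) - 1"
proof -
  have "0 \<in> K"
    using K by (rule is_subfieldD)
  then have "(\<Sum>x\<in>K. \<chi> x) = (\<Sum>x\<in>K - {0}. 1)" and "card K > 0"
    using assms(2,3) by (auto simp: sum.remove [of K 0] card_gt_0_iff)
  then show ?thesis
    using \<open>0 \<in> K\<close> by (simp add: card_Diff_singleton)
qed

section \<open>Power residue characters\<close>

lemma ex_mult_character_primitive_element:
  fixes g :: "'a::{field,finite}"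
  assumes g: "primitive_element g" and \<zeta>: "\<zeta> ^ (CARD('a) - 1) = 1"
  shows "\<exists>\<chi>. mult_character \<chi> \<and> (\<forall>n. \<chi> (g ^ n) = \<zeta> ^ n)"
proof -
  define \<chi> where "\<chi> x = (if x = 0 then 0 else \<zeta> ^ (SOME n. x = g ^ n))" for x
  have powers: "\<chi> (g ^ n) = \<zeta> ^ n" for n
  proof -
    have "g ^ n = g ^ (SOME m. g ^ n = g ^ m)"
      by (rule someI) (rule refl)
    then have "\<zeta> ^ n = \<zeta> ^ (SOME m. g ^ n = g ^ m)"
      unfolding primitive_element_power_eq_iff [OF g] by (rule power_cong_of_power_eq_1 [OF \<zeta>])
    moreover have "g ^ n \<noteq> 0"
      using g unfolding primitive_element_def by blast
    then have "\<chi> (g ^ n) = \<zeta> ^ (SOME m. g ^ n = g ^ m)"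
      unfolding \<chi>_def by (rule if_not_P)
    ultimately show ?thesis
      by simp
  qed
  have "\<chi> (x * y) = \<chi> x * \<chi> y" for x y
  proof (cases "x = 0 \<or> y = 0")
    case False
    then obtain m n where xy: "x = g ^ m" "y = g ^ n"
      using g unfolding primitive_element_def by meson
    show ?thesis
      unfolding xy power_add [symmetric] powers ..
  qed (auto simp: \<chi>_def)
  moreover have "\<chi> 1 = 1"
    using powers [of 0] by simp
  ultimately show ?thesis
    using powers unfolding mult_character_def by blast
qed

lemma ex_mult_character_kernel_powers:
  assumes d: "d dvd CARD('a::{field,finite}) - 1"
  shows "\<exists>\<chi> :: 'a \<Rightarrow> complex. mult_character \<chi> \<and> (\<forall>x. x \<noteq> 0 \<longrightarrow> (\<chi> x = 1 \<longleftrightarrow> is_nonzero_power d x))"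
proof -
  obtain g :: 'a where g: "primitive_element g"
    using ex_primitive_element by blast
  have "d > 0"
    using d card_units_pos [where ?'a = 'a] by (intro gr0I) simp
  then obtain \<zeta> :: complex where \<zeta>: "\<And>n. \<zeta> ^ n = 1 \<longleftrightarrow> d dvd n"
    using cis_two_pi_div_power_eq_1_iff by blast
  then obtain \<chi> where \<chi>: "mult_character \<chi>" "\<And>n. \<chi> (g ^ n) = \<zeta> ^ n"
    using ex_mult_character_primitive_element [OF g] d by blast
  have "\<chi> x = 1 \<longleftrightarrow> is_nonzero_power d x" if x: "x \<noteq> 0" for x
  proof -
    obtain n where "x = g ^ n"
      using g x by (auto simp: primitive_element_def)
    then show ?thesis
      by (simp only: \<chi>(2) \<zeta> is_nonzero_power_primitive_element_iff [OF g d])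
  qed
  with \<chi>(1) show ?thesis
    by blast
qed

definition residue_character :: "nat \<Rightarrow> 'a::{field,finite} \<Rightarrow> complex" where
  "residue_character d = (SOME \<chi>. mult_character \<chi> \<and>
     (\<forall>x. x \<noteq> 0 \<longrightarrow> (\<chi> x = 1 \<longleftrightarrow> is_nonzero_power d x)))"

context
  fixes d :: nat
  assumes d: "d dvd CARD('a::{field,finite}) - 1"
begin

lemma mult_character_residue_character: "mult_character (residue_character d :: 'a \<Rightarrow> complex)"
  and residue_character_eq_1_iff:
    "x \<noteq> 0 \<Longrightarrow> residue_character d (x :: 'a) = 1 \<longleftrightarrow> is_nonzero_power d x"
  using someI_ex [OF ex_mult_character_kernel_powers [OF d]]
  unfolding residue_character_def by blast+

lemma residue_character_power_eq_1:
  assumes "x \<noteq> 0" and "d dvd m"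
  shows "residue_character d (x :: 'a) ^ m = 1"
proof -
  obtain k where "m = k * d"
    using assms(2) by (metis dvd_div_mult_self)
  then have "is_nonzero_power d (x ^ m)"
    using assms(1) by (auto simp: is_nonzero_power_def power_mult intro!: exI [of _ "x ^ k"])
  then show ?thesis
    using assms(1) residue_character_eq_1_iff [of "x ^ m"]
    by (simp add: mult_character_power [OF mult_character_residue_character])
qed

lemma ex_residue_character_exact_order:
  "\<exists>x :: 'a. x \<noteq> 0 \<and> (\<forall>i. residue_character d x ^ i = 1 \<longleftrightarrow> d dvd i)"
proof -
  obtain g :: 'a where g: "primitive_element g"
    using ex_primitive_element by blast
  then have nonzero: "g ^ i \<noteq> 0" for i
    unfolding primitive_element_def by blast
  have "residue_character d g ^ i = 1 \<longleftrightarrow> d dvd i" for i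
    unfolding mult_character_power [OF mult_character_residue_character, symmetric]
    by (simp only: residue_character_eq_1_iff [OF nonzero] is_nonzero_power_primitive_element_iff [OF g d])
  then show ?thesis
    using nonzero [of 1] by auto
qed

end

definition nonpower_weight :: "nat \<Rightarrow> 'a::{field,finite} \<Rightarrow> complex" where
  "nonpower_weight d x = - (\<Sum>j\<in>{1..<d}. residue_character d x ^ j) / of_nat (d - 1)"

lemma nonpower_indicator:
  fixes x :: "'a::{field,finite}"
  assumes d: "d dvd CARD('a) - 1" "d > 1" and x: "x \<noteq> 0"
  shows "of_real (1 - 1 / real d) * (1 + nonpower_weight d x) = of_bool (\<not> is_nonzero_power d x)"
proof -
  let ?z = "residue_character d x" and ?c = "of_nat d :: complex"
  have "(\<Sum>j<d. ?z ^ j) = 1 + (\<Sum>j\<in>{1..<d}. ?z ^ j)"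
    using d(2) by (simp add: lessThan_atLeast0 sum.atLeast_Suc_lessThan)
  moreover have "(\<Sum>j<d. ?z ^ j) = (if is_nonzero_power d x then ?c else 0)"
    using sum_powers_root_of_unity [OF residue_character_power_eq_1 [OF d(1) x dvd_refl]]
    by (simp add: residue_character_eq_1_iff [OF d(1) x])
  ultimately have "(\<Sum>j\<in>{1..<d}. ?z ^ j) = (if is_nonzero_power d x then ?c - 1 else - 1)"
    by (auto simp: algebra_simps add_eq_0_iff)
  moreover have "?c \<noteq> 1" "?c \<noteq> 0"
    using d(2) by auto
  ultimately show ?thesis
    using d(2) by (simp add: nonpower_weight_def field_simps)
qed

definition square_nonfourth_weight :: "'a::{field,finite} \<Rightarrow> complex" where
  "square_nonfourth_weight x = (\<Sum>i<4. (- 1) ^ i * residue_character 4 x ^ i)"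

lemma square_nonfourth_indicator:
  fixes x :: "'a::{field,finite}"
  assumes four: "4 dvd CARD('a) - 1" and x: "x \<noteq> 0"
  shows "square_nonfourth_weight x = 4 * of_bool (is_nonzero_power 2 x \<and> \<not> is_nonzero_power 4 x)"
proof -
  let ?z = "residue_character 4 x"
  have "?z\<^sup>2 = residue_character 4 (x\<^sup>2)"
    by (simp add: mult_character_power [OF mult_character_residue_character [OF four]])
  then have "?z\<^sup>2 = 1 \<longleftrightarrow> is_nonzero_power 2 x"
    using four x is_nonzero_power_power_iff [of 2 2 x] by (simp add: residue_character_eq_1_iff)
  then have eq_minus_1_iff: "- ?z = 1 \<longleftrightarrow> is_nonzero_power 2 x \<and> \<not> is_nonzero_power 4 x"
    using residue_character_eq_1_iff [OF four x] by (auto simp: power2_eq_1_iff minus_equation_iff)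
  have "(- ?z) ^ 4 = 1"
    using residue_character_power_eq_1 [OF four x dvd_refl] by simp
  then have "(\<Sum>i<4. (- ?z) ^ i) = (if - ?z = 1 then of_nat 4 else 0)"
    by (rule sum_powers_root_of_unity)
  then show ?thesis
    unfolding eq_minus_1_iff square_nonfourth_weight_def by (simp add: power_minus [of ?z])
qed

section \<open>Character sums over an affine line\<close>

locale quadratic_line =
  fixes q :: nat and K :: "'a::{field,finite} set" and \<theta>1 \<theta>2 :: 'a
  assumes card_field: "CARD('a) = q\<^sup>2" and subfield: "is_subfield K" and card_K: "card K = q"
    and basis: "is_basis2 K \<theta>1 \<theta>2"
begin

lemmas K_closed = is_subfieldD [OF subfield]

lemma q_ge_2: "q \<ge> 2"
proof -
  have "card {0, 1 :: 'a} \<le> card K"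
    by (rule card_mono) (auto simp: K_closed)
  then show ?thesis
    by (simp add: card_K)
qed

lemma card_units: "CARD('a) - 1 = (q - 1) * (q + 1)"
  by (simp add: card_field power2_eq_square algebra_simps)

lemma subfield_unit_is_power:
  assumes "x \<in> K" and "x \<noteq> 0"
  shows "is_nonzero_power (q + 1) x"
  using subfield_power_card_eq_1 [OF subfield assms]
  by (intro is_nonzero_power_of_power_eq_1 [OF card_units assms(2)]) (simp add: card_K)

definition point :: "'a \<Rightarrow> 'a" where
  "point \<alpha> = \<theta>1 + \<alpha> * \<theta>2"

lemma basis_eq_iff:
  assumes "a \<in> K" "b \<in> K" "c \<in> K" "d \<in> K"
  shows "a * \<theta>1 + b * \<theta>2 = c * \<theta>1 + d * \<theta>2 \<longleftrightarrow> a = c \<and> b = d"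
proof
  assume "a * \<theta>1 + b * \<theta>2 = c * \<theta>1 + d * \<theta>2"
  then have "(a - c) * \<theta>1 + (b - d) * \<theta>2 = 0"
    by (simp add: algebra_simps)
  moreover have "a - c \<in> K" "b - d \<in> K"
    using assms by (auto intro: K_closed)
  ultimately have "a - c = 0 \<and> b - d = 0"
    using basis unfolding is_basis2_def by blast
  then show "a = c \<and> b = d"
    by simp
qed simp

lemma point_nonzero: "\<alpha> \<in> K \<Longrightarrow> point \<alpha> \<noteq> 0"
  using basis_eq_iff [of 1 \<alpha> 0 0] by (simp add: point_def K_closed)

lemma point_eq_mult_point_iff:
  assumes "a \<in> K" "b \<in> K" "z \<in> K"
  shows "point a = z * point b \<longleftrightarrow> z = 1 \<and> a = b"
  using basis_eq_iff [of 1 a z "z * b"] assms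
  by (auto simp: point_def K_closed algebra_simps)

lemma point_diff: "point a - point b = (a - b) * \<theta>2"
  by (simp add: point_def algebra_simps)

lemma ratio_notin_subfield:
  assumes "a \<in> K" "b \<in> K" "a \<noteq> b"
  shows "point a / point b \<notin> K"
proof
  assume "point a / point b \<in> K"
  moreover have "point a = (point a / point b) * point b"
    using point_nonzero assms(2) by simp
  ultimately show False
    using point_eq_mult_point_iff assms by metis
qed

lemma ratio_eqD:
  assumes in_K: "a \<in> K" "b \<in> K" "a' \<in> K" "b' \<in> K" and neq: "a \<noteq> b"
    and eq: "point a / point b = point a' / point b'"
  shows "a = a' \<and> b = b'"
proof -
  define z where "z = point a / point b"
  have "point a = z * point b"
    using in_K point_nonzero by (simp add: z_def)
  moreover have "point a' = z * point b'"
    using in_K point_nonzero unfolding z_def eq by simp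
  ultimately have "point a - point a' = z * (point b - point b')"
    by (simp add: algebra_simps)
  moreover have "\<theta>2 \<noteq> 0"
    using basis_eq_iff [of 0 1 0 0] by (auto simp: K_closed)
  ultimately have diff: "a - a' = z * (b - b')"
    by (simp add: point_diff)
  have "b = b'"
  proof (rule ccontr)
    assume "b \<noteq> b'"
    with diff have "z = (a - a') / (b - b')"
      by (simp add: field_simps)
    then have "z \<in> K"
      using in_K by (simp add: K_closed)
    then show False
      using ratio_notin_subfield in_K neq by (auto simp: z_def)
  qed
  with diff show ?thesis
    by simp
qed

lemma inj_on_ratio: "inj_on (\<lambda>(a, b). point a / point b) (SIGMA a:K. K - {a})"
proof (rule inj_onI)
  fix u v
  assume "u \<in> (SIGMA a:K. K - {a})" "v \<in> (SIGMA a:K. K - {a})"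
    and "(case u of (a, b) \<Rightarrow> point a / point b) = (case v of (a, b) \<Rightarrow> point a / point b)"
  then show "u = v"
    using ratio_eqD [of "fst u" "snd u" "fst v" "snd v"] by (auto simp: case_prod_unfold prod_eq_iff)
qed

lemma bij_betw_ratio: "bij_betw (\<lambda>(a, b). point a / point b) (SIGMA a:K. K - {a}) (- K)"
proof -
  have "card (SIGMA a:K. K - {a}) = card (- K)"
    by (simp add: card_SigmaI Compl_eq_Diff_UNIV card_Diff_subset card_field card_K
        power2_eq_square algebra_simps)
  then have "(\<lambda>(a, b). point a / point b) ` (SIGMA a:K. K - {a}) = - K"
    using ratio_notin_subfield by (intro card_subset_eq) (auto simp: card_image [OF inj_on_ratio]
        simp del: card_SigmaI)
  then show ?thesis
    using inj_on_ratio by (simp add: bij_betw_def)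
qed

definition line_sum :: "('a \<Rightarrow> complex) \<Rightarrow> complex" where
  "line_sum \<chi> = (\<Sum>\<alpha>\<in>K. \<chi> (point \<alpha>))"

context
  fixes \<chi> :: "'a \<Rightarrow> complex"
  assumes \<chi>: "mult_character \<chi>" and nontrivial: "\<exists>c. c \<noteq> 0 \<and> \<chi> c \<noteq> 1"
begin

lemma norm_line_sum_square: "of_real ((norm (line_sum \<chi>))\<^sup>2) = of_nat q - (\<Sum>x\<in>K. \<chi> x)"
proof -
  have total: "(\<Sum>x\<in>UNIV. \<chi> x) = 0"
    using nontrivial sum_subfield_mult_character_eq_0 [of UNIV, OF _ \<chi>] by (auto simp: is_subfield_def)
  have "of_real ((norm (line_sum \<chi>))\<^sup>2) = line_sum \<chi> * cnj (line_sum \<chi>)"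
    by (rule complex_norm_square)
  also have "\<dots> = (\<Sum>a\<in>K. \<Sum>b\<in>K. \<chi> (point a / point b))"
    by (simp add: line_sum_def cnj_sum sum_product mult_character_divide [OF \<chi>] point_nonzero)
  also have "\<dots> = (\<Sum>a\<in>K. 1 + (\<Sum>b\<in>K - {a}. \<chi> (point a / point b)))"
    using \<chi> by (intro sum.cong refl) (simp add: sum.remove point_nonzero)
  also have "\<dots> = of_nat q + (\<Sum>(a, b)\<in>(SIGMA a:K. K - {a}). \<chi> (point a / point b))"
    by (simp add: sum.distrib card_K sum.Sigma)
  also have "(\<Sum>(a, b)\<in>(SIGMA a:K. K - {a}). \<chi> (point a / point b)) = (\<Sum>x\<in>- K. \<chi> x)"
    using sum.reindex_bij_betw [OF bij_betw_ratio, of \<chi>] by (simp add: case_prod_unfold)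
  also have "\<dots> = (\<Sum>x\<in>UNIV. \<chi> x) - (\<Sum>x\<in>K. \<chi> x)"
    unfolding Compl_eq_Diff_UNIV by (rule sum_diff) auto
  finally show ?thesis
    by (simp add: total)
qed

lemma norm_line_sum_trivial_on_subfield:
  assumes "\<And>x. x \<in> K \<Longrightarrow> x \<noteq> 0 \<Longrightarrow> \<chi> x = 1"
  shows "norm (line_sum \<chi>) = 1"
proof -
  have "\<chi> 0 = 0"
    using \<chi> nontrivial nontrivial_mult_character_0 by blast
  then have "complex_of_real ((norm (line_sum \<chi>))\<^sup>2) = of_real 1"
    unfolding norm_line_sum_square
    using assms by (simp add: sum_subfield_trivial_mult_character [OF subfield] card_K)
  then have "(norm (line_sum \<chi>))\<^sup>2 = 1"
    unfolding of_real_eq_iff .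
  then show ?thesis
    by (simp only: abs_square_eq_1 abs_norm_cancel)
qed

lemma norm_line_sum_le: "norm (line_sum \<chi>) \<le> sqrt q"
proof (cases "\<forall>x\<in>K. x \<noteq> 0 \<longrightarrow> \<chi> x = 1")
  case True
  then show ?thesis
    using norm_line_sum_trivial_on_subfield q_ge_2 by simp
next
  case False
  then have "(\<Sum>x\<in>K. \<chi> x) = 0"
    using sum_subfield_mult_character_eq_0 [OF subfield \<chi>] by blast
  then have "complex_of_real ((norm (line_sum \<chi>))\<^sup>2) = of_real q"
    unfolding norm_line_sum_square by simp
  then show ?thesis
    unfolding of_real_eq_iff by (simp add: real_le_rsqrt)
qed

end

end

section \<open>Sieve sums\<close>

lemma norm_sum_times_prod_le:
  fixes c :: "'x \<Rightarrow> 'b::real_normed_field" and f :: "'p \<Rightarrow> 'j \<Rightarrow> 'x \<Rightarrow> 'b"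
  assumes fin: "finite D" "\<And>p. p \<in> D \<Longrightarrow> finite (J p)"
    and weights: "\<And>p. p \<in> D \<Longrightarrow> (\<Sum>j\<in>J p. norm (w p j)) = 1"
    and bound: "\<And>j. j \<in> PiE D J \<Longrightarrow> norm (\<Sum>x\<in>A. c x * (\<Prod>p\<in>D. f p (j p) x)) \<le> B"
  shows "norm (\<Sum>x\<in>A. c x * (\<Prod>p\<in>D. \<Sum>j\<in>J p. w p j * f p j x)) \<le> B"
proof -
  have "(\<Sum>x\<in>A. c x * (\<Prod>p\<in>D. \<Sum>j\<in>J p. w p j * f p j x)) =
      (\<Sum>x\<in>A. \<Sum>j\<in>PiE D J. (\<Prod>p\<in>D. w p (j p)) * (c x * (\<Prod>p\<in>D. f p (j p) x)))"
    using fin by (simp add: prod_sum_PiE prod.distrib sum_distrib_left mult.left_commute)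
  also have "\<dots> = (\<Sum>j\<in>PiE D J. (\<Prod>p\<in>D. w p (j p)) * (\<Sum>x\<in>A. c x * (\<Prod>p\<in>D. f p (j p) x)))"
    by (subst sum.swap) (simp add: sum_distrib_left)
  also have "norm \<dots> \<le> (\<Sum>j\<in>PiE D J. (\<Prod>p\<in>D. norm (w p (j p))) * B)"
    using bound by (intro sum_norm_le) (simp add: norm_mult prod_norm mult_left_mono)
  also have "\<dots> = (\<Prod>p\<in>D. \<Sum>j\<in>J p. norm (w p j)) * B"
    using fin by (simp add: prod_sum_PiE sum_distrib_right)
  finally show ?thesis
    using weights by simp
qed

definition odd_prime_factors :: "nat \<Rightarrow> nat set" where
  "odd_prime_factors n = {p. prime p \<and> odd p \<and> p dvd n}"

locale odd_quadratic_line = quadratic_line +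
  assumes odd_q: "odd q"
begin

abbreviation sieving_primes :: "nat set" where
  "sieving_primes \<equiv> odd_prime_factors (q\<^sup>2 - 1)"

lemma sieving_primeD:
  assumes "p \<in> sieving_primes"
  shows "prime p" "odd p" "p dvd CARD('a) - 1" "p > 1"
  using assms prime_gt_1_nat by (auto simp: odd_prime_factors_def card_field)

lemma finite_sieving_primes: "finite sieving_primes"
proof (rule finite_subset)
  show "sieving_primes \<subseteq> {..CARD('a) - 1}"
    using sieving_primeD(3) card_units_pos [where ?'a = 'a] by (auto intro: dvd_imp_le)
qed simp

lemma finite_subset_sieving_primes: "D \<subseteq> sieving_primes \<Longrightarrow> finite D"
  using finite_sieving_primes by (rule finite_subset [rotated])

lemma four_dvd_card_units: "4 dvd CARD('a) - 1"
proof -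
  have "2 * 2 dvd (q - 1) * (q + 1)"
    using odd_q by (intro mult_dvd_mono) auto
  then show ?thesis
    unfolding card_units by simp
qed

definition sieve_character :: "nat \<Rightarrow> nat set \<Rightarrow> (nat \<Rightarrow> nat) \<Rightarrow> 'a \<Rightarrow> complex" where
  "sieve_character i D j x = residue_character 4 x ^ i * (\<Prod>p\<in>D. residue_character p x ^ j p)"

lemma mult_character_sieve_character:
  assumes "D \<subseteq> sieving_primes"
  shows "mult_character (sieve_character i D j)"
  unfolding sieve_character_def using assms four_dvd_card_units sieving_primeD(3)
  by (intro mult_character_times mult_character_prod mult_character_pointwise_power
      mult_character_residue_character) auto

lemma sieve_character_power_eq:
  assumes D: "D \<subseteq> sieving_primes" and y: "y \<noteq> 0" and i: "4 dvd m * i"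
    and E: "E \<subseteq> D" "\<And>p. p \<in> D - E \<Longrightarrow> p dvd m"
  shows "sieve_character i D j (y ^ m) = (\<Prod>p\<in>E. residue_character p y ^ (m * j p))"
proof -
  have "sieve_character i D j (y ^ m) =
      residue_character 4 y ^ (m * i) * (\<Prod>p\<in>D. residue_character p y ^ (m * j p))"
    using D sieving_primeD(3) four_dvd_card_units
    by (auto simp: sieve_character_def power_mult mult_character_power [OF mult_character_residue_character]
        intro!: prod.cong)
  also have "residue_character 4 y ^ (m * i) = 1"
    using four_dvd_card_units y i by (rule residue_character_power_eq_1)
  also have "(\<Prod>p\<in>D. residue_character p y ^ (m * j p)) = (\<Prod>p\<in>E. residue_character p y ^ (m * j p))"
    using D y E sieving_primeD(3) finite_subset_sieving_primes [OF D]
    by (intro prod.mono_neutral_right) (auto intro!: residue_character_power_eq_1)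
  finally show ?thesis
    by simp
qed

text \<open>Raising to the power \<open>m = 4 \<Prod>(D - {r})\<close> kills every factor but the one belonging to \<open>r\<close>.\<close>

lemma sieve_character_nontrivial:
  assumes D: "D \<subseteq> sieving_primes" and r: "r \<in> D" and j: "j r \<in> {1..<r}"
  shows "\<exists>c. c \<noteq> 0 \<and> sieve_character i D j c \<noteq> 1"
proof -
  define m where "m = 4 * \<Prod>(D - {r})"
  have fin: "finite D"
    using D by (rule finite_subset_sieving_primes)
  have r_prime: "prime r" "odd r" "r dvd CARD('a) - 1"
    using D r sieving_primeD by blast+
  obtain y :: 'a where y: "y \<noteq> 0" "\<And>n. residue_character r y ^ n = 1 \<longleftrightarrow> r dvd n"
    using ex_residue_character_exact_order [OF r_prime(3)] by blast
  have "sieve_character i D j (y ^ m) = (\<Prod>p\<in>{r}. residue_character p y ^ (m * j p))"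
    using r fin by (intro sieve_character_power_eq D y(1)) (auto simp: m_def intro: dvd_mult dvd_prodI)
  moreover have "\<not> r dvd m * j r"
  proof -
    have "\<not> r dvd 2 ^ 2"
      using r_prime(1,2) by (metis prime_dvd_power primes_dvd_imp_eq two_is_prime_nat even_numeral)
    moreover have "\<not> r dvd p" if "p \<in> D - {r}" for p
      using that D r_prime(1) sieving_primeD(1) primes_dvd_imp_eq by blast
    moreover have "\<not> r dvd j r"
      using j by (auto dest: dvd_imp_le)
    ultimately show ?thesis
      using r_prime(1) fin by (simp add: m_def prime_dvd_mult_iff prime_dvd_prod_iff)
  qed
  ultimately show ?thesis
    using y by (intro exI [of _ "y ^ m"]) simp
qed

lemma sieve_character_empty_nontrivial:
  assumes "0 < i" "i < 4"
  shows "\<exists>c. c \<noteq> 0 \<and> sieve_character i {} j c \<noteq> 1"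
proof -
  obtain c :: 'a where "c \<noteq> 0" "\<And>n. residue_character 4 c ^ n = 1 \<longleftrightarrow> 4 dvd n"
    using ex_residue_character_exact_order [OF four_dvd_card_units] by blast
  then show ?thesis
    using assms by (intro exI [of _ c]) (auto simp: sieve_character_def dest: dvd_imp_le)
qed

lemma sieve_character_trivial_on_subfield:
  assumes "D \<subseteq> sieving_primes" "\<forall>p\<in>D. p dvd q + 1" and "4 dvd (q + 1) * i"
    and "x \<in> K" "x \<noteq> 0"
  shows "sieve_character i D j x = 1"
proof -
  obtain y where y: "y \<noteq> 0" "x = y ^ (q + 1)"
    using subfield_unit_is_power assms(4,5) by (auto simp: is_nonzero_power_def)
  have "sieve_character i D j (y ^ (q + 1)) = (\<Prod>p\<in>{}. residue_character p y ^ ((q + 1) * j p))"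
    using assms(1-3) y(1) by (intro sieve_character_power_eq) auto
  then show ?thesis
    by (simp add: y(2))
qed

definition twisted_line_sum :: "nat \<Rightarrow> nat set \<Rightarrow> complex" where
  "twisted_line_sum i D =
     (\<Sum>\<alpha>\<in>K. residue_character 4 (point \<alpha>) ^ i * (\<Prod>p\<in>D. nonpower_weight p (point \<alpha>)))"

lemma norm_twisted_line_sum_le_bound:
  assumes D: "D \<subseteq> sieving_primes"
    and bound: "\<And>j. j \<in> (\<Pi>\<^sub>E p\<in>D. {1..<p}) \<Longrightarrow> norm (line_sum (sieve_character i D j)) \<le> B"
  shows "norm (twisted_line_sum i D) \<le> B"
proof -
  let ?w = "\<lambda>p. - 1 / of_nat (p - 1) :: complex"
  have "nonpower_weight p x = (\<Sum>j\<in>{1..<p}. ?w p * residue_character p x ^ j)" for p and x :: 'a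
    unfolding nonpower_weight_def sum_distrib_left [symmetric] by simp
  then have "twisted_line_sum i D = (\<Sum>\<alpha>\<in>K. residue_character 4 (point \<alpha>) ^ i *
      (\<Prod>p\<in>D. \<Sum>j\<in>{1..<p}. ?w p * residue_character p (point \<alpha>) ^ j))"
    by (simp only: twisted_line_sum_def)
  also have "norm \<dots> \<le> B"
  proof (rule norm_sum_times_prod_le)
    show "(\<Sum>j\<in>{1..<p}. norm (?w p)) = 1" if "p \<in> D" for p
      using that D sieving_primeD(4) [of p] by (auto simp: norm_divide simp del: of_nat_diff)
    show "norm (\<Sum>\<alpha>\<in>K. residue_character 4 (point \<alpha>) ^ i *
        (\<Prod>p\<in>D. residue_character p (point \<alpha>) ^ j p)) \<le> B" if "j \<in> (\<Pi>\<^sub>E p\<in>D. {1..<p})" for j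
      using bound [OF that] by (simp add: line_sum_def sieve_character_def)
  qed (use finite_subset_sieving_primes [OF D] in auto)
  finally show ?thesis .
qed

definition twist_bound :: "nat \<Rightarrow> real" where
  "twist_bound i = (if 4 dvd (q + 1) * i then 1 else sqrt q)"

lemma norm_twisted_line_sum_le:
  assumes D: "D \<subseteq> sieving_primes" and nontrivial: "D \<noteq> {} \<or> 0 < i \<and> i < 4"
  shows "norm (twisted_line_sum i D) \<le> sqrt q"
    and "\<forall>p\<in>D. p dvd q + 1 \<Longrightarrow> norm (twisted_line_sum i D) \<le> twist_bound i"
proof -
  have character: "mult_character (sieve_character i D j)" for j
    using D by (rule mult_character_sieve_character)
  have character_nontrivial: "\<exists>c. c \<noteq> 0 \<and> sieve_character i D j c \<noteq> 1" if j: "j \<in> (\<Pi>\<^sub>E p\<in>D. {1..<p})" for j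
  proof (cases "D = {}")
    case True
    with nontrivial show ?thesis
      using sieve_character_empty_nontrivial by simp
  next
    case False
    then obtain r where "r \<in> D"
      by blast
    with j show ?thesis
      by (intro sieve_character_nontrivial [OF D]) auto
  qed
  show le_sqrt: "norm (twisted_line_sum i D) \<le> sqrt q"
    using character character_nontrivial by (intro norm_twisted_line_sum_le_bound [OF D] norm_line_sum_le)
  assume exceptional: "\<forall>p\<in>D. p dvd q + 1"
  show "norm (twisted_line_sum i D) \<le> twist_bound i"
  proof (cases "4 dvd (q + 1) * i")
    case True
    have "norm (line_sum (sieve_character i D j)) = 1" if "j \<in> (\<Pi>\<^sub>E p\<in>D. {1..<p})" for j
      using character character_nontrivial [OF that]
        sieve_character_trivial_on_subfield [OF D exceptional True]
      by (rule norm_line_sum_trivial_on_subfield)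
    with True show ?thesis
      by (intro norm_twisted_line_sum_le_bound [OF D]) (simp add: twist_bound_def)
  qed (use le_sqrt in \<open>simp add: twist_bound_def\<close>)
qed

lemma twisted_line_sum_trivial: "twisted_line_sum 0 {} = of_nat q"
  by (simp add: twisted_line_sum_def card_K)

definition sieve_sum :: "nat set \<Rightarrow> complex" where
  "sieve_sum D = (\<Sum>i<4. (- 1) ^ i * twisted_line_sum i D)"

text \<open>The saving over the bound \<open>sqrt q\<close>, on average over the four twists, for a set of primes
  all of which divide \<open>q + 1\<close>.\<close>

definition subfield_gain :: real where
  "subfield_gain = sqrt q - (\<Sum>i<4. twist_bound i) / 4"

definition sieve_bound :: "nat set \<Rightarrow> real" where
  "sieve_bound D = 4 * (sqrt q - (if \<forall>p\<in>D. p dvd q + 1 then subfield_gain else 0))"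

lemma Re_sieve_sum_ge:
  assumes "D \<subseteq> sieving_primes" "D \<noteq> {}"
  shows "Re (sieve_sum D) \<ge> - sieve_bound D"
proof -
  have "norm (sieve_sum D) \<le> (\<Sum>i<4. norm (twisted_line_sum i D))"
    unfolding sieve_sum_def by (rule order_trans [OF norm_sum]) (simp add: norm_mult norm_power)
  also have "\<dots> \<le> sieve_bound D"
  proof (cases "\<forall>p\<in>D. p dvd q + 1")
    case True
    then have "(\<Sum>i<4. norm (twisted_line_sum i D)) \<le> (\<Sum>i<4. twist_bound i)"
      using assms by (intro sum_mono norm_twisted_line_sum_le(2)) auto
    with True show ?thesis
      by (simp add: sieve_bound_def subfield_gain_def)
  next
    case False
    have "(\<Sum>i<4::nat. norm (twisted_line_sum i D)) \<le> (\<Sum>i<4::nat. sqrt q)"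
      using assms by (intro sum_mono norm_twisted_line_sum_le(1)) auto
    with False show ?thesis
      by (auto simp: sieve_bound_def)
  qed
  finally show ?thesis
    using abs_Re_le_cmod [of "sieve_sum D"] by linarith
qed

lemma Re_sieve_sum_empty_ge: "Re (sieve_sum {}) \<ge> real q + 1 - sieve_bound {}"
proof -
  have split: "(\<Sum>i<4. h i) = h 0 + (\<Sum>i\<in>{1..<4}. h i)" for h :: "nat \<Rightarrow> 'b::comm_monoid_add"
    by (simp add: lessThan_atLeast0 sum.atLeast_Suc_lessThan)
  let ?S = "\<Sum>i\<in>{1..<4}. (- 1) ^ i * twisted_line_sum i {}"
  have "norm ?S \<le> (\<Sum>i\<in>{1..<4}. twist_bound i)"
    using norm_twisted_line_sum_le(2) [of "{}"] by (intro sum_norm_le) (auto simp: norm_mult norm_power)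
  moreover have "sieve_bound {} = 1 + (\<Sum>i\<in>{1..<4}. twist_bound i)"
    by (simp add: sieve_bound_def subfield_gain_def split twist_bound_def)
  moreover have "sieve_sum {} = of_nat q + ?S"
    unfolding sieve_sum_def split by (simp add: twisted_line_sum_trivial)
  ultimately show ?thesis
    using abs_Re_le_cmod [of ?S] by simp
qed

end

section \<open>The prime sieve\<close>

lemma card_sieve_ge:
  fixes w :: "'p \<Rightarrow> real" and A :: "'x set" and H :: "'p \<Rightarrow> 'x \<Rightarrow> bool"
  defines "n \<equiv> \<lambda>P. real (card {x \<in> A. \<forall>p\<in>P. H p x})"
  assumes "finite A" "finite R"
  shows "n (P \<union> R) \<ge> (1 - (\<Sum>p\<in>R. w p)) * n P + (\<Sum>p\<in>R. n (insert p P) - (1 - w p) * n P)"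
proof -
  let ?S = "\<lambda>P. {x \<in> A. \<forall>p\<in>P. H p x}"
  have card_diff: "real (card (?S P - ?S (insert p P))) = n P - n (insert p P)" for p
    unfolding n_def using assms
    by (subst card_Diff_subset) (auto intro!: of_nat_diff card_mono)
  have "?S P \<subseteq> ?S (P \<union> R) \<union> (\<Union>p\<in>R. ?S P - ?S (insert p P))"
    by auto
  then have "card (?S P) \<le> card (?S (P \<union> R) \<union> (\<Union>p\<in>R. ?S P - ?S (insert p P)))"
    using assms by (intro card_mono) auto
  also have "\<dots> \<le> card (?S (P \<union> R)) + card (\<Union>p\<in>R. ?S P - ?S (insert p P))"
    by (rule card_Un_le)
  also have "\<dots> \<le> card (?S (P \<union> R)) + (\<Sum>p\<in>R. card (?S P - ?S (insert p P)))"
    using assms by (intro add_left_mono card_UN_le)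
  finally have "n P \<le> n (P \<union> R) + (\<Sum>p\<in>R. real (card (?S P - ?S (insert p P))))"
    unfolding n_def by (simp flip: of_nat_sum of_nat_add)
  then have "n P - (\<Sum>p\<in>R. n P - n (insert p P)) \<le> n (P \<union> R)"
    unfolding card_diff by simp
  also have "n P - (\<Sum>p\<in>R. n P - n (insert p P)) =
      (1 - (\<Sum>p\<in>R. w p)) * n P + (\<Sum>p\<in>R. n (insert p P) - (1 - w p) * n P)"
    by (simp add: algebra_simps sum.distrib sum_subtractf sum_distrib_left)
  finally show ?thesis .
qed

context odd_quadratic_line
begin

definition square_nonfourth_points :: "'a set" where
  "square_nonfourth_points =
     {\<alpha> \<in> K. is_nonzero_power 2 (point \<alpha>) \<and> \<not> is_nonzero_power 4 (point \<alpha>)}"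

definition sifted_points :: "nat set \<Rightarrow> 'a set" where
  "sifted_points P = {\<alpha> \<in> square_nonfourth_points. \<forall>p\<in>P. \<not> is_nonzero_power p (point \<alpha>)}"

definition sieve_density :: "nat set \<Rightarrow> real" where
  "sieve_density P = (\<Prod>p\<in>P. 1 - 1 / real p)"

lemma sifted_points_indicator:
  assumes P: "P \<subseteq> sieving_primes" and \<alpha>: "\<alpha> \<in> K"
  shows "4 * of_bool (\<alpha> \<in> sifted_points P) = of_real (sieve_density P) *
    (square_nonfourth_weight (point \<alpha>) *
     (\<Sum>D\<in>Pow P. \<Prod>p\<in>D. nonpower_weight p (point \<alpha>)))"
proof -
  let ?x = "point \<alpha>"
  have x: "?x \<noteq> 0"
    using \<alpha> by (rule point_nonzero)
  have fin: "finite P"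
    using P by (rule finite_subset_sieving_primes)
  have "(of_bool (\<forall>p\<in>P. \<not> is_nonzero_power p ?x) :: complex) =
      (\<Prod>p\<in>P. of_bool (\<not> is_nonzero_power p ?x))"
    using fin by (induction P rule: finite_induct) auto
  also have "\<dots> = (\<Prod>p\<in>P. of_real (1 - 1 / real p) * (nonpower_weight p ?x + 1))"
  proof (rule prod.cong [OF refl])
    fix p assume "p \<in> P"
    then have "p dvd CARD('a) - 1" "p > 1"
      using P sieving_primeD by blast+
    from nonpower_indicator [OF this x, symmetric]
    show "of_bool (\<not> is_nonzero_power p ?x) = of_real (1 - 1 / real p) * (nonpower_weight p ?x + 1)"
      by (simp only: add.commute)
  qed
  also have "\<dots> = of_real (sieve_density P) * (\<Sum>D\<in>Pow P. \<Prod>p\<in>D. nonpower_weight p ?x)"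
    by (simp only: prod.distrib of_real_prod sieve_density_def prod_add [OF fin] prod.neutral_const mult_1_right)
  finally have sifted: "(of_bool (\<forall>p\<in>P. \<not> is_nonzero_power p ?x) :: complex) =
      of_real (sieve_density P) * (\<Sum>D\<in>Pow P. \<Prod>p\<in>D. nonpower_weight p ?x)" .
  have "square_nonfourth_weight ?x = 4 * of_bool (\<alpha> \<in> square_nonfourth_points)"
    using \<alpha> by (simp add: square_nonfourth_indicator [OF four_dvd_card_units x] square_nonfourth_points_def)
  then have "4 * of_bool (\<alpha> \<in> sifted_points P) =
      square_nonfourth_weight ?x * of_bool (\<forall>p\<in>P. \<not> is_nonzero_power p ?x)"
    by (simp add: sifted_points_def)
  then show ?thesis
    unfolding sifted by (simp only: mult.left_commute)
qed

definition sieve_total :: "nat set \<Rightarrow> nat set \<Rightarrow> real" where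
  "sieve_total E P = (\<Sum>D\<in>Pow P. Re (sieve_sum (E \<union> D)))"

lemma sieve_sum_eq:
  "sieve_sum D = (\<Sum>\<alpha>\<in>K. square_nonfourth_weight (point \<alpha>) *
     (\<Prod>p\<in>D. nonpower_weight p (point \<alpha>)))"
  unfolding square_nonfourth_weight_def sieve_sum_def twisted_line_sum_def sum_distrib_left sum_distrib_right
  by (subst sum.swap) (simp only: mult.assoc)

lemma card_sifted_points:
  assumes P: "P \<subseteq> sieving_primes"
  shows "4 * real (card (sifted_points P)) = sieve_density P * sieve_total {} P"
proof -
  have "sifted_points P \<subseteq> K"
    by (auto simp: sifted_points_def square_nonfourth_points_def)
  then have "complex_of_real (4 * real (card (sifted_points P))) =
      (\<Sum>\<alpha>\<in>K. 4 * of_bool (\<alpha> \<in> sifted_points P))"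
    by (simp add: sum_of_bool_eq Int_absorb1 flip: sum_distrib_left)
  also have "\<dots> = (\<Sum>\<alpha>\<in>K. of_real (sieve_density P) * (square_nonfourth_weight (point \<alpha>) *
     (\<Sum>D\<in>Pow P. \<Prod>p\<in>D. nonpower_weight p (point \<alpha>))))"
    using sifted_points_indicator [OF P] by (rule sum.cong [OF refl])
  also have "\<dots> = of_real (sieve_density P) * (\<Sum>D\<in>Pow P. sieve_sum D)"
    unfolding sieve_sum_eq sum_distrib_left by (rule sum.swap)
  finally have "complex_of_real (4 * real (card (sifted_points P))) =
      of_real (sieve_density P) * (\<Sum>D\<in>Pow P. sieve_sum D)" .
  from arg_cong [OF this, of Re] show ?thesis
    by (simp add: sieve_total_def Re_sum)
qed

lemma card_sifted_points_insert:
  assumes P: "P \<subseteq> sieving_primes" and p: "p \<in> sieving_primes - P"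
  shows "4 * (real (card (sifted_points (insert p P))) - (1 - 1 / real p) * real (card (sifted_points P))) =
    sieve_density P * ((1 - 1 / real p) * sieve_total {p} P)"
proof -
  let ?n = "\<lambda>P. real (card (sifted_points P))" and ?w = "1 - 1 / real p"
  have fin: "finite P"
    using P by (rule finite_subset_sieving_primes)
  have density: "sieve_density (insert p P) = ?w * sieve_density P"
    using p fin by (simp add: sieve_density_def)
  have total: "sieve_total {} (insert p P) = sieve_total {} P + sieve_total {p} P"
  proof -
    have "sieve_total {} (insert p P) =
        sieve_total {} P + (\<Sum>D\<in>insert p ` Pow P. Re (sieve_sum D))"
      unfolding Pow_insert sieve_total_def using fin p by (subst sum.union_disjoint) auto
    also have "(\<Sum>D\<in>insert p ` Pow P. Re (sieve_sum D)) = sieve_total {p} P"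
      unfolding sieve_total_def using p by (subst sum.reindex) (auto simp: inj_on_def)
    finally show ?thesis .
  qed
  have "4 * (?n (insert p P) - ?w * ?n P) = 4 * ?n (insert p P) - ?w * (4 * ?n P)"
    by (simp only: right_diff_distrib mult.left_commute)
  also have "4 * ?n P = sieve_density P * sieve_total {} P"
    using P by (rule card_sifted_points)
  also have "4 * ?n (insert p P) = sieve_density (insert p P) * sieve_total {} (insert p P)"
    using P p by (intro card_sifted_points) auto
  finally show ?thesis
    unfolding density total by (simp add: algebra_simps)
qed

definition exceptional :: "nat set \<Rightarrow> nat set" where
  "exceptional P = {p \<in> P. p dvd q + 1}"

lemma sum_sieve_bound:
  assumes "finite P"
  shows "(\<Sum>D\<in>Pow P. sieve_bound (E \<union> D)) = 4 * (2 ^ card P * sqrt q -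
    (if \<forall>p\<in>E. p dvd q + 1 then 2 ^ card (exceptional P) * subfield_gain else 0))"
proof (cases "\<forall>p\<in>E. p dvd q + 1")
  case True
  then have "(\<Sum>D\<in>Pow P. sieve_bound (E \<union> D)) =
      (\<Sum>D\<in>Pow P. 4 * (sqrt q - of_bool (D \<in> Pow (exceptional P)) * subfield_gain))"
    by (intro sum.cong refl) (auto simp: sieve_bound_def exceptional_def)
  also have "\<dots> = 4 * (2 ^ card P * sqrt q -
      (\<Sum>D\<in>Pow P. of_bool (D \<in> Pow (exceptional P))) * subfield_gain)"
    using assms by (simp add: sum_subtractf sum_distrib_right card_Pow algebra_simps flip: sum_distrib_left)
  also have "(\<Sum>D\<in>Pow P. of_bool (D \<in> Pow (exceptional P))) = real (card (Pow P \<inter> Pow (exceptional P)))"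
    using assms by (simp add: sum_of_bool_eq Int_def del: Pow_iff)
  also have "Pow P \<inter> Pow (exceptional P) = Pow (exceptional P)"
    by (auto simp: exceptional_def)
  also have "real (card (Pow (exceptional P))) = 2 ^ card (exceptional P)"
    using assms by (simp add: card_Pow exceptional_def)
  finally show ?thesis
    using True by simp
next
  case False
  then have "sieve_bound (E \<union> D) = 4 * sqrt q" for D
    by (auto simp: sieve_bound_def)
  then show ?thesis
    unfolding if_not_P [OF False] using assms by (simp add: card_Pow)
qed

lemma sieve_total_empty_ge:
  assumes P: "P \<subseteq> sieving_primes"
  shows "sieve_total {} P \<ge> real q + 1 - 4 * (2 ^ card P * sqrt q - 2 ^ card (exceptional P) * subfield_gain)"
proof -
  have fin: "finite P"
    using P by (rule finite_subset_sieving_primes)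
  have split: "(\<Sum>D\<in>Pow P. h D) = h {} + (\<Sum>D\<in>Pow P - {{}}. h D)" for h :: "nat set \<Rightarrow> real"
    using fin by (intro sum.remove) auto
  have "(\<Sum>D\<in>Pow P - {{}}. Re (sieve_sum D)) \<ge> (\<Sum>D\<in>Pow P - {{}}. - sieve_bound D)"
    using P by (intro sum_mono Re_sieve_sum_ge) auto
  then have "sieve_total {} P \<ge> real q + 1 - (\<Sum>D\<in>Pow P. sieve_bound D)"
    using Re_sieve_sum_empty_ge by (simp add: sieve_total_def split sum_negf)
  then show ?thesis
    using sum_sieve_bound [OF fin, of "{}"] by simp
qed

lemma sieve_total_singleton_ge:
  assumes P: "P \<subseteq> sieving_primes" and p: "p \<in> sieving_primes"
  shows "sieve_total {p} P \<ge> - 4 * (2 ^ card P * sqrt q -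
    (if p dvd q + 1 then 2 ^ card (exceptional P) * subfield_gain else 0))"
proof -
  have "sieve_total {p} P \<ge> (\<Sum>D\<in>Pow P. - sieve_bound ({p} \<union> D))"
    unfolding sieve_total_def using P p by (intro sum_mono Re_sieve_sum_ge) auto
  then show ?thesis
    using sum_sieve_bound [OF finite_subset_sieving_primes [OF P], of "{p}"] by (simp add: sum_negf)
qed

lemma sieve_density_pos:
  assumes "P \<subseteq> sieving_primes"
  shows "sieve_density P > 0"
  unfolding sieve_density_def using assms sieving_primeD(4)
  by (intro prod_pos) (fastforce simp: field_simps)

lemma weighted_sum_sieve_total_ge:
  fixes w :: "nat \<Rightarrow> real"
  assumes P: "P \<subseteq> sieving_primes" and R: "R \<subseteq> sieving_primes" and w: "\<And>p. p \<in> R \<Longrightarrow> w p \<ge> 0"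
  shows "(\<Sum>p\<in>R. w p * sieve_total {p} P) \<ge> - 4 * (sum w R * (2 ^ card P * sqrt q) -
    sum w (exceptional R) * (2 ^ card (exceptional P) * subfield_gain))"
proof -
  let ?B = "2 ^ card P * sqrt q" and ?G = "2 ^ card (exceptional P) * subfield_gain"
  have "(\<Sum>p\<in>R. w p * (- 4 * (?B - (if p dvd q + 1 then ?G else 0)))) =
      - 4 * (sum w R * ?B - (\<Sum>p\<in>R. if p dvd q + 1 then w p * ?G else 0))"
    unfolding sum_distrib_right sum_distrib_left sum_subtractf [symmetric]
    by (intro sum.cong refl) (simp add: algebra_simps)
  also have "(\<Sum>p\<in>R. if p dvd q + 1 then w p * ?G else 0) = sum w (exceptional R) * ?G"
    unfolding exceptional_def sum_distrib_right
    using finite_subset_sieving_primes [OF R] by (simp only: sum.inter_filter)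
  finally have "- 4 * (sum w R * ?B - sum w (exceptional R) * ?G) =
      (\<Sum>p\<in>R. w p * (- 4 * (?B - (if p dvd q + 1 then ?G else 0))))" ..
  also have "\<dots> \<le> (\<Sum>p\<in>R. w p * sieve_total {p} P)"
    using R w by (intro sum_mono mult_left_mono sieve_total_singleton_ge P) auto
  finally show ?thesis .
qed

lemma card_sifted_points_union_ge:
  fixes P R :: "nat set"
  defines "\<epsilon> \<equiv> 1 - (\<Sum>p\<in>R. 1 / real p)" and "\<epsilon>' \<equiv> 1 - (\<Sum>p\<in>exceptional R. 1 / real p)"
    and "B \<equiv> 2 ^ card P * sqrt q" and "G \<equiv> 2 ^ card (exceptional P) * subfield_gain"
  assumes P: "P \<subseteq> sieving_primes" and R: "R \<subseteq> sieving_primes" and disjoint: "P \<inter> R = {}"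
    and "\<epsilon> \<ge> 0"
  shows "4 * real (card (sifted_points (P \<union> R))) \<ge> sieve_density P *
    (\<epsilon> * (real q + 1) -
      4 * ((real (card R) - 1 + 2 * \<epsilon>) * B - (real (card (exceptional R)) - 1 + \<epsilon>' + \<epsilon>) * G))"
    (is "_ \<ge> _ * ?bound")
proof -
  let ?n = "\<lambda>P. real (card (sifted_points P))" and ?w = "\<lambda>p. 1 - 1 / real p"
  let ?Y = "\<Sum>p\<in>R. ?w p * sieve_total {p} P"
  have "\<epsilon> * sieve_total {} P \<ge> \<epsilon> * (real q + 1 - 4 * (B - G))"
    using sieve_total_empty_ge [OF P] \<open>\<epsilon> \<ge> 0\<close> unfolding B_def G_def by (rule mult_left_mono)
  moreover have "?Y \<ge> - 4 * (sum ?w R * B - sum ?w (exceptional R) * G)"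
    unfolding B_def G_def using R sieving_primeD(4)
    by (intro weighted_sum_sieve_total_ge P) (fastforce simp: field_simps)+
  moreover have "sum ?w R = real (card R) - 1 + \<epsilon>"
    and "sum ?w (exceptional R) = real (card (exceptional R)) - 1 + \<epsilon>'"
    by (simp_all add: \<epsilon>_def \<epsilon>'_def sum_subtractf)
  ultimately have "?bound \<le> \<epsilon> * sieve_total {} P + ?Y"
    by (simp add: algebra_simps)
  then have "sieve_density P * ?bound \<le> sieve_density P * (\<epsilon> * sieve_total {} P + ?Y)"
    using sieve_density_pos [OF P] by (intro mult_left_mono) auto
  also have "\<dots> = \<epsilon> * (4 * ?n P) + (\<Sum>p\<in>R. 4 * (?n (insert p P) - ?w p * ?n P))"
  proof -
    have "(\<Sum>p\<in>R. 4 * (?n (insert p P) - ?w p * ?n P)) = (\<Sum>p\<in>R. sieve_density P * (?w p * sieve_total {p} P))"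
      using R disjoint by (intro sum.cong refl card_sifted_points_insert P) auto
    then show ?thesis
      unfolding card_sifted_points [OF P] by (simp only: distrib_left sum_distrib_left mult.left_commute)
  qed
  also have "\<dots> = 4 * (\<epsilon> * ?n P + (\<Sum>p\<in>R. ?n (insert p P) - ?w p * ?n P))"
    by (simp only: distrib_left sum_distrib_left mult.left_commute)
  also have "\<epsilon> * ?n P + (\<Sum>p\<in>R. ?n (insert p P) - ?w p * ?n P) \<le> ?n (P \<union> R)"
    unfolding \<epsilon>_def sifted_points_def using finite_subset_sieving_primes [OF R]
    by (intro card_sieve_ge) (simp_all add: square_nonfourth_points_def)
  finally show ?thesis
    by simp
qed

lemma subfield_gain_1_mod_4:
  assumes "[q = 1] (mod 4)"
  shows "subfield_gain = (sqrt q - 1) / 2"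
proof -
  have "\<not> 4 dvd q + 1" "4 dvd (q + 1) * 2" "\<not> 4 dvd (q + 1) * 3"
    using assms unfolding cong_def by presburger+
  then have "twist_bound 0 + twist_bound 1 + twist_bound 2 + twist_bound 3 = 2 * sqrt q + 2"
    by (simp add: twist_bound_def)
  moreover have "(\<Sum>i<4. twist_bound i) = twist_bound 0 + twist_bound 1 + twist_bound 2 + twist_bound 3"
    by (simp add: eval_nat_numeral)
  ultimately show ?thesis
    by (simp add: subfield_gain_def field_simps)
qed

lemma subfield_gain_3_mod_4:
  assumes "[q = 3] (mod 4)"
  shows "subfield_gain = sqrt q - 1"
proof -
  have "4 dvd q + 1"
    using assms unfolding cong_def by presburger
  then have "twist_bound i = 1" for i
    unfolding twist_bound_def by (simp only: dvd_mult2 if_True)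
  then show ?thesis
    by (simp add: subfield_gain_def)
qed

end

section \<open>Freeness and square-free divisors\<close>

lemma prime_factors_prod_primes:
  assumes "finite X" and "\<And>p. p \<in> X \<Longrightarrow> prime (p::nat)"
  shows "prime_factors (\<Prod>X) = X"
proof -
  have "0 \<notin> (\<lambda>p. p) ` X"
    using assms(2) not_prime_0 by (metis image_ident)
  then have "prime_factors (\<Prod>X) = (\<Union>p\<in>X. prime_factors p)"
    using assms(1) by (simp add: prime_factors_prod)
  also have "\<dots> = X"
    using assms(2) by (simp add: prime_prime_factors)
  finally show ?thesis .
qed

lemma squarefree_prod_primes:
  assumes "\<And>p. p \<in> X \<Longrightarrow> prime (p::nat)"
  shows "squarefree (\<Prod>X)"
  using assms by (intro squarefree_prod_coprime) (auto simp: squarefree_prime primes_coprime)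

lemma prod_prime_factors_squarefree:
  assumes "squarefree (d::nat)"
  shows "\<Prod>(prime_factors d) = d"
proof -
  have d: "d \<noteq> 0"
    using assms by (metis not_squarefree_0)
  then have "\<Prod>(prime_factors d) = (\<Prod>p\<in>prime_factors d. p ^ multiplicity p d)"
    using assms by (intro prod.cong) (auto simp: squarefree_factorial_semiring')
  also have "\<dots> = d"
    using d by (simp add: prod_prime_factors)
  finally show ?thesis .
qed

lemma prod_prime_factors_subset_dvd:
  assumes "n > 0" and "X \<subseteq> prime_factors (n::nat)"
  shows "\<Prod>X dvd n"
proof -
  have "\<Prod>X dvd \<Prod>(prime_factors n)"
    using assms by (intro prod_dvd_prod_subset) auto
  also have "\<dots> dvd (\<Prod>p\<in>prime_factors n. p ^ multiplicity p n)"
    using assms by (intro prod_dvd_prod) (auto simp: prime_factors_multiplicity)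
  also have "\<dots> = n"
    using assms by (simp add: prod_prime_factors)
  finally show ?thesis .
qed

lemma W_eq_power:
  assumes "n > 0"
  shows "W n = 2 ^ card (prime_factors n)"
proof -
  have primes: "finite X" "\<And>p. p \<in> X \<Longrightarrow> prime p" if "X \<subseteq> prime_factors n" for X
    using that finite_subset [of X "prime_factors n"] by auto
  have "bij_betw Prod (Pow (prime_factors n)) {d. d dvd n \<and> squarefree d}"
  proof (rule bij_betw_byWitness [where f' = prime_factors])
    show "\<forall>X\<in>Pow (prime_factors n). prime_factors (\<Prod>X) = X"
      using primes by (auto intro!: prime_factors_prod_primes)
    show "\<forall>d\<in>{d. d dvd n \<and> squarefree d}. \<Prod>(prime_factors d) = d"
      by (auto simp: prod_prime_factors_squarefree)
    show "Prod ` Pow (prime_factors n) \<subseteq> {d. d dvd n \<and> squarefree d}"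
      using primes assms by (auto intro!: prod_prime_factors_subset_dvd squarefree_prod_primes)
    show "prime_factors ` {d. d dvd n \<and> squarefree d} \<subseteq> Pow (prime_factors n)"
      using assms dvd_prime_factors [of n] by auto
  qed
  then show ?thesis
    unfolding W_def by (simp add: bij_betw_same_card [symmetric] card_Pow)
qed

lemma t_free_iff:
  fixes x :: "'a::field"
  assumes "t > 0" and "x \<noteq> 0"
  shows "t_free t x \<longleftrightarrow> (\<forall>p\<in>prime_factors t. \<not> is_nonzero_power p x)"
proof
  assume free: "t_free t x"
  show "\<forall>p\<in>prime_factors t. \<not> is_nonzero_power p x"
  proof (intro ballI notI)
    fix p assume p: "p \<in> prime_factors t" "is_nonzero_power p x"
    then have "p = 1"
      using free by (auto simp: t_free_def is_nonzero_power_def in_prime_factors_iff)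
    with p(1) show False
      by (simp add: in_prime_factors_iff)
  qed
next
  assume no_prime_power: "\<forall>p\<in>prime_factors t. \<not> is_nonzero_power p x"
  have "d = 1" if d: "d dvd t" "\<zeta> \<noteq> 0" "x = \<zeta> ^ d" for d \<zeta>
  proof (rule ccontr)
    assume "d \<noteq> 1"
    then obtain p where p: "prime p" "p dvd d"
      using prime_factor_nat by blast
    then have "x = (\<zeta> ^ (d div p)) ^ p"
      using d by (simp flip: power_mult)
    then have "is_nonzero_power p x"
      using d(2) by (auto simp: is_nonzero_power_def intro!: exI [of _ "\<zeta> ^ (d div p)"])
    moreover have "p \<in> prime_factors t"
      using p d(1) assms(1) by (auto simp: prime_factors_dvd intro: dvd_trans)
    ultimately show False
      using no_prime_power by blast
  qed
  then show "t_free t x"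
    using assms(2) by (auto simp: t_free_def)
qed

lemma finite_odd_prime_factors: "n > 0 \<Longrightarrow> finite (odd_prime_factors n)"
  by (rule finite_subset [of _ "{..n}"]) (auto simp: odd_prime_factors_def dest: dvd_imp_le)

lemma odd_radical_eq: "odd_radical n = \<Prod>(odd_prime_factors n)"
  by (simp add: odd_radical_def odd_prime_factors_def)

lemma odd_radical_pos: "odd_radical n > 0"
  using squarefree_prod_primes [of "odd_prime_factors n"]
  by (intro gr0I) (auto simp: odd_radical_eq odd_prime_factors_def)

lemma prime_factors_odd_radical: "n > 0 \<Longrightarrow> prime_factors (odd_radical n) = odd_prime_factors n"
  unfolding odd_radical_eq
  by (rule prime_factors_prod_primes [OF finite_odd_prime_factors]) (auto simp: odd_prime_factors_def)

context odd_quadratic_line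
begin

lemma Q_count_odd_radical:
  "Q_count K \<theta>1 \<theta>2 (odd_radical (q\<^sup>2 - 1)) = card (sifted_points sieving_primes)"
proof -
  have "prime_factors (odd_radical (q\<^sup>2 - 1)) = sieving_primes"
    using card_units_pos [where ?'a = 'a] by (intro prime_factors_odd_radical) (simp add: card_field)
  then show ?thesis
    using odd_radical_pos point_nonzero
    by (auto simp: Q_count_def sifted_points_def square_nonfourth_points_def t_free_iff point_def
        intro!: arg_cong [where f = card])
qed

lemma sieving_primes_eq_union:
  assumes "odd_radical (q\<^sup>2 - 1) = k * \<Prod>R" and "finite R" "\<And>p. p \<in> R \<Longrightarrow> prime p"
  shows "sieving_primes = prime_factors k \<union> R"
proof -
  have "k \<noteq> 0" "\<Prod>R \<noteq> 0"
    using assms(1) odd_radical_pos [of "q\<^sup>2 - 1"] by (auto intro: gr0I)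
  then have "prime_factors (k * \<Prod>R) = prime_factors k \<union> R"
    by (simp add: prime_factors_product prime_factors_prod_primes [OF assms(2,3)])
  then show ?thesis
    using card_units_pos [where ?'a = 'a] by (simp add: card_field prime_factors_odd_radical flip: assms(1))
qed

lemma Q_count_neq_0:
  fixes k :: nat and R :: "nat set"
  defines "\<epsilon> \<equiv> 1 - (\<Sum>p\<in>R. 1 / real p)" and "\<epsilon>' \<equiv> 1 - (\<Sum>p\<in>exceptional R. 1 / real p)"
  assumes k: "odd_radical (q\<^sup>2 - 1) = k * \<Prod>R"
    and R: "finite R" "\<And>p. p \<in> R \<Longrightarrow> prime p" "\<And>p. p \<in> R \<Longrightarrow> \<not> p dvd k"
    and "\<epsilon> > 0"
    and large: "real q + 1 > 4 * (real (W k) * ((real (card R) - 1) / \<epsilon> + 2) * sqrt q -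
      real (W (gcd k (q + 1))) * ((real (card (exceptional R)) - 1 + \<epsilon>') / \<epsilon> + 1) * subfield_gain)"
  shows "Q_count K \<theta>1 \<theta>2 (odd_radical (q\<^sup>2 - 1)) \<noteq> 0"
proof -
  let ?P = "prime_factors k"
  have "k > 0"
    using k odd_radical_pos [of "q\<^sup>2 - 1"] by (intro gr0I) simp
  then have W_gcd: "real (W (gcd k (q + 1))) = 2 ^ card (exceptional ?P)" and W_k: "real (W k) = 2 ^ card ?P"
    by (auto simp: W_eq_power exceptional_def prime_factors_dvd intro!: arg_cong [where f = card])
  have union: "sieving_primes = ?P \<union> R"
    using k R(1,2) by (rule sieving_primes_eq_union)
  then have P: "?P \<subseteq> sieving_primes" and "R \<subseteq> sieving_primes"
    by blast+
  have "?P \<inter> R = {}"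
    using R(3) by (auto simp: in_prime_factors_iff)
  have "4 * real (card (sifted_points (?P \<union> R))) \<ge> sieve_density ?P * (\<epsilon> * (real q + 1) -
      4 * ((real (card R) - 1 + 2 * \<epsilon>) * (real (W k) * sqrt q) -
        (real (card (exceptional R)) - 1 + \<epsilon>' + \<epsilon>) * (real (W (gcd k (q + 1))) * subfield_gain)))"
    using P \<open>R \<subseteq> sieving_primes\<close> \<open>?P \<inter> R = {}\<close> \<open>\<epsilon> > 0\<close> unfolding \<epsilon>_def \<epsilon>'_def W_gcd W_k
    by (intro card_sifted_points_union_ge) simp_all
  moreover have "sieve_density ?P > 0"
    using P by (rule sieve_density_pos)
  moreover have "\<epsilon> * (4 * (real (W k) * ((real (card R) - 1) / \<epsilon> + 2) * sqrt q -
        real (W (gcd k (q + 1))) * ((real (card (exceptional R)) - 1 + \<epsilon>') / \<epsilon> + 1) * subfield_gain)) =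
      4 * ((real (card R) - 1 + 2 * \<epsilon>) * (real (W k) * sqrt q) -
        (real (card (exceptional R)) - 1 + \<epsilon>' + \<epsilon>) * (real (W (gcd k (q + 1))) * subfield_gain))"
    using \<open>\<epsilon> > 0\<close> by (simp add: field_simps)
  moreover note mult_strict_left_mono [OF large \<open>\<epsilon> > 0\<close>]
  ultimately have "real (card (sifted_points (?P \<union> R))) > 0"
    by (smt (verit) mult_pos_pos)
  then show ?thesis
    unfolding Q_count_odd_radical union by linarith
qed

end

theorem theorem6p7:
  fixes q k k1 r s :: nat
    and K :: "'a::{field,finite} set"
    and \<beta> \<theta>1 \<theta>2 :: 'a
    and p :: "nat \<Rightarrow> nat"
    and \<epsilon> \<epsilon>' :: real
  assumes "primepow q" and "odd q"
    and "CARD('a) = q\<^sup>2"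
    and "is_subfield K" and "card K = q"
    and "\<beta> \<in> K" and "\<beta> \<noteq> 0"
    and "is_basis2 K \<theta>1 \<theta>2"
    and "Tr q \<theta>1 = \<beta>" and "Tr q \<theta>2 = 0"
    and "odd_radical (q\<^sup>2 - 1) = k * (\<Prod>i=1..s. p i)"
    and "\<forall>i\<in>{1..s}. prime (p i) \<and> \<not> p i dvd k"
    and "inj_on p {1..s}"
    and "r \<le> s"
    and "\<forall>i\<in>{1..r}. p i dvd q + 1"
    and "\<forall>i\<in>{r<..s}. \<not> p i dvd q + 1"
    and "\<epsilon> = 1 - (\<Sum>i=1..s. 1 / real (p i))"
    and "\<epsilon>' = 1 - (\<Sum>i=1..r. 1 / real (p i))"
    and "k1 = Max {d. d dvd k \<and> d dvd q + 1}"
    and "\<epsilon> > 0"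
  shows "([q = 1] (mod 4) \<and>
          real q + 1 > 4 * (real (W k) * ((real s - 1) / \<epsilon> + 2) * sqrt (real q)
            - real (W k1) * ((real r - 1 + \<epsilon>') / \<epsilon> + 1) * ((sqrt (real q) - 1) / 2))
          \<longrightarrow> Q_count K \<theta>1 \<theta>2 (odd_radical (q\<^sup>2 - 1)) \<noteq> 0) \<and>
         ([q = 3] (mod 4) \<and>
          real q + 1 > 4 * (real (W k) * ((real s - 1) / \<epsilon> + 2) * sqrt (real q)
            - real (W k1) * ((real r - 1 + \<epsilon>') / \<epsilon> + 1) * (sqrt (real q) - 1))
          \<longrightarrow> Q_count K \<theta>1 \<theta>2 (odd_radical (q\<^sup>2 - 1)) \<noteq> 0)"
proof -
  interpret odd_quadratic_line q K \<theta>1 \<theta>2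
    by unfold_locales (use assms(2-5,8) in auto)
  let ?R = "p ` {1..s}"
  have index_iff: "i \<in> {1..s} \<and> p i dvd q + 1 \<longleftrightarrow> i \<in> {1..r}" for i
    using assms(14-16) by (cases "i \<le> r") auto
  have "exceptional ?R = p ` {i \<in> {1..s}. p i dvd q + 1}"
    by (auto simp: exceptional_def)
  then have exceptional: "exceptional ?R = p ` {1..r}"
    by (simp only: index_iff Collect_mem_eq)
  have inj: "inj_on p {1..r}"
    using assms(14) by (intro inj_on_subset [OF assms(13)]) simp
  have radical: "odd_radical (q\<^sup>2 - 1) = k * \<Prod>?R"
    using assms(11,13) by (simp add: prod.reindex)
  have \<epsilon>: "\<epsilon> = 1 - (\<Sum>l\<in>?R. 1 / real l)" and \<epsilon>': "\<epsilon>' = 1 - (\<Sum>l\<in>exceptional ?R. 1 / real l)"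
    unfolding exceptional using assms(13,17,18) inj by (simp_all add: sum.reindex)
  have cardinalities: "real s = real (card ?R)" "real r = real (card (exceptional ?R))"
    unfolding exceptional using assms(13) inj by (simp_all add: card_image)
  have k1: "k1 = gcd k (q + 1)"
    using assms(19) by (simp add: gcd_is_Max_divisors_nat)
  have "Q_count K \<theta>1 \<theta>2 (odd_radical (q\<^sup>2 - 1)) \<noteq> 0"
    if "real q + 1 > 4 * (real (W k) * ((real s - 1) / \<epsilon> + 2) * sqrt (real q)
      - real (W k1) * ((real r - 1 + \<epsilon>') / \<epsilon> + 1) * subfield_gain)"
    using assms(12,20) that unfolding \<epsilon> \<epsilon>' cardinalities k1 by (intro Q_count_neq_0 [OF radical]) auto
  then show ?thesis
    using subfield_gain_1_mod_4 subfield_gain_3_mod_4 by metis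
qed

end
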